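(* Let $G$ and $H$ be graphs in $\Gamma_3$. If $G,H$ have negative or positive senders, then every minimal $(G,H,e,f)$-sender, either negative or positive, is connected.
   Context: All graphs are simple and finite. A 2-coloring of the edges of a graph $F=(V_F,E_F)$ is a map $\mathbf c:E_F\to\{0,1\}$ (0 = red, 1 = blue). For fixed graphs $G,H$, such a coloring is $(G,H)$-good if there is no subgraph of $F$ isomorphic to $G$ all of whose edges are red and no subgraph isomorphic to $H$ all of whose edges are blue. A positive $(G,H,e,f)$-sender is a graph $\mathcal T$ containing two edges $e,f$ (the signal edges) such that: (1) $\mathcal T$ has a $(G,H)$-good coloring; (2) $e$ and $f$ receive the same color in every $(G,H)$-good coloring of $\mathcal T$; (3) there is a $(G,H)$-good coloring of $\mathcal T$ in which $e$ is red and one in which $e$ is blue. A negative $(G,H,e,f)$-sender satisfies (1) and (3) and, instead of (2), that $e$ and $f$ receive different colors in every $(G,H)$-good coloring. "$G,H$ have negative (positive) senders" means some negative (positive) $(G,H,e,f)$-sender exists for some edges $e,f$. A sender with signal edges $e,f$ is minimal if none of its proper subgraphs is a sender of the same type with the same signal edges $e,f$. $\Gamma_3$ denotes the class consisting of all 3-connected graphs together with the triangle $K_3$. *)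

theory Defs
  imports Main
begin

record 'v ugraph =
  verts :: "'v set"
  edges :: "'v set set"

text \<open>Finite simple graphs; an edge is the two-element set of its endpoints.\<close>

definition simple_graph :: "'v ugraph \<Rightarrow> bool" where
  "simple_graph F \<longleftrightarrow> finite (verts F) \<and> (\<forall>e\<in>edges F. e \<subseteq> verts F \<and> card e = 2)"

definition subgraph :: "'v ugraph \<Rightarrow> 'v ugraph \<Rightarrow> bool" where
  "subgraph S F \<longleftrightarrow> simple_graph S \<and> verts S \<subseteq> verts F \<and> edges S \<subseteq> edges F"

definition proper_subgraph :: "'v ugraph \<Rightarrow> 'v ugraph \<Rightarrow> bool" where
  "proper_subgraph S F \<longleftrightarrow> subgraph S F \<and> S \<noteq> F"

definition isomorphic :: "'a ugraph \<Rightarrow> 'b ugraph \<Rightarrow> bool" where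
  "isomorphic F F' \<longleftrightarrow> (\<exists>h. bij_betw h (verts F) (verts F') \<and>
     (\<forall>u\<in>verts F. \<forall>v\<in>verts F. {u, v} \<in> edges F \<longleftrightarrow> {h u, h v} \<in> edges F'))"

definition connected_graph :: "'v ugraph \<Rightarrow> bool" where
  "connected_graph F \<longleftrightarrow> verts F \<noteq> {} \<and>
     (\<forall>u\<in>verts F. \<forall>v\<in>verts F. (u, v) \<in> {(x, y). {x, y} \<in> edges F}\<^sup>*)"

definition delete_verts :: "'v ugraph \<Rightarrow> 'v set \<Rightarrow> 'v ugraph" where
  "delete_verts F X = \<lparr>verts = verts F - X, edges = {e \<in> edges F. e \<inter> X = {}}\<rparr>"

text \<open>As usual, a \<open>k\<close>-connected graph has more than \<open>k\<close> vertices; so the triangle is not 3-connected.\<close>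

definition k_connected :: "nat \<Rightarrow> 'v ugraph \<Rightarrow> bool" where
  "k_connected k F \<longleftrightarrow> card (verts F) > k \<and>
     (\<forall>X. X \<subseteq> verts F \<and> card X < k \<longrightarrow> connected_graph (delete_verts F X))"

definition is_complete_graph :: "nat \<Rightarrow> 'v ugraph \<Rightarrow> bool" where
  "is_complete_graph n F \<longleftrightarrow> card (verts F) = n \<and> edges F = {e. e \<subseteq> verts F \<and> card e = 2}"

definition Gamma3 :: "'v ugraph set" where
  "Gamma3 = {F. simple_graph F \<and> (k_connected 3 F \<or> is_complete_graph 3 F)}"

datatype color = Red | Blue

text \<open>A coloring of the edges of \<open>F\<close> is a total function of which only the values on
  \<^term>\<open>edges F\<close> matter.\<close>

definition good_coloring :: "'a ugraph \<Rightarrow> 'b ugraph \<Rightarrow> 'v ugraph \<Rightarrow> ('v set \<Rightarrow> color) \<Rightarrow> bool" where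
  "good_coloring G H F c \<longleftrightarrow>
     \<not> (\<exists>S. subgraph S F \<and> isomorphic G S \<and> (\<forall>e\<in>edges S. c e = Red)) \<and>
     \<not> (\<exists>S. subgraph S F \<and> isomorphic H S \<and> (\<forall>e\<in>edges S. c e = Blue))"

definition positive_sender ::
  "'a ugraph \<Rightarrow> 'b ugraph \<Rightarrow> 'v ugraph \<Rightarrow> 'v set \<Rightarrow> 'v set \<Rightarrow> bool" where
  "positive_sender G H T e f \<longleftrightarrow>
     simple_graph T \<and> e \<in> edges T \<and> f \<in> edges T \<and> e \<noteq> f \<and>
     (\<exists>c. good_coloring G H T c) \<and>
     (\<forall>c. good_coloring G H T c \<longrightarrow> c e = c f) \<and>
     (\<exists>c. good_coloring G H T c \<and> c e = Red) \<and>
     (\<exists>c. good_coloring G H T c \<and> c e = Blue)"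

definition negative_sender ::
  "'a ugraph \<Rightarrow> 'b ugraph \<Rightarrow> 'v ugraph \<Rightarrow> 'v set \<Rightarrow> 'v set \<Rightarrow> bool" where
  "negative_sender G H T e f \<longleftrightarrow>
     simple_graph T \<and> e \<in> edges T \<and> f \<in> edges T \<and> e \<noteq> f \<and>
     (\<exists>c. good_coloring G H T c) \<and>
     (\<forall>c. good_coloring G H T c \<longrightarrow> c e \<noteq> c f) \<and>
     (\<exists>c. good_coloring G H T c \<and> c e = Red) \<and>
     (\<exists>c. good_coloring G H T c \<and> c e = Blue)"

text \<open>Every finite graph is isomorphic to one whose vertices are natural numbers, so existence of
  a sender may be expressed over \<^typ>\<open>nat\<close>.\<close>

definition has_positive_senders :: "'a ugraph \<Rightarrow> 'b ugraph \<Rightarrow> bool" where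
  "has_positive_senders G H \<longleftrightarrow> (\<exists>(T :: nat ugraph) e f. positive_sender G H T e f)"

definition has_negative_senders :: "'a ugraph \<Rightarrow> 'b ugraph \<Rightarrow> bool" where
  "has_negative_senders G H \<longleftrightarrow> (\<exists>(T :: nat ugraph) e f. negative_sender G H T e f)"

definition minimal_positive_sender ::
  "'a ugraph \<Rightarrow> 'b ugraph \<Rightarrow> 'v ugraph \<Rightarrow> 'v set \<Rightarrow> 'v set \<Rightarrow> bool" where
  "minimal_positive_sender G H T e f \<longleftrightarrow>
     positive_sender G H T e f \<and>
     (\<forall>S. proper_subgraph S T \<longrightarrow> \<not> positive_sender G H S e f)"

definition minimal_negative_sender ::
  "'a ugraph \<Rightarrow> 'b ugraph \<Rightarrow> 'v ugraph \<Rightarrow> 'v set \<Rightarrow> 'v set \<Rightarrow> bool" where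
  "minimal_negative_sender G H T e f \<longleftrightarrow>
     negative_sender G H T e f \<and>
     (\<forall>S. proper_subgraph S T \<longrightarrow> \<not> negative_sender G H S e f)"

end

(* The graphs in Gamma_3 are connected, so every copy of G or H in T lies within a union of
   components or avoids it; hence good colorings of the two sides can be glued freely. If the
   component A of e missed f, gluing a coloring with e red on A and one with e blue elsewhere
   would break the dependence between e and f. So A contains both signal edges, every
   good coloring of A extends to T, and A is itself a sender; minimality forces A = T. *)

theory Submission
  imports Defs
begin

text \<open>Membership in \<open>A\<close> is preserved along each edge, hence along each path.
  \<open>A\<close> need not lie inside \<open>verts F\<close>, so \<open>F\<close> can be a copy of
  \<open>G\<close> or \<open>H\<close> while \<open>A\<close> is a union of components of the host
  graph.\<close>

lemma connected_graph_closed_set: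
  assumes "connected_graph F" and "\<And>x y. {x, y} \<in> edges F \<Longrightarrow> x \<in> A \<longleftrightarrow> y \<in> A"
  shows "verts F \<subseteq> A \<or> verts F \<inter> A = {}"
proof -
  have "u \<in> A \<longleftrightarrow> v \<in> A" if "(u, v) \<in> {(x, y). {x, y} \<in> edges F}\<^sup>*" for u v
    using that by (induction rule: rtrancl_induct) (use assms(2) in auto)
  then show ?thesis
    using assms(1) unfolding connected_graph_def by blast
qed

lemma isomorphic_connected_graph:
  assumes "simple_graph F" "connected_graph F" "isomorphic F F'"
  shows "connected_graph F'"
proof -
  obtain h where h: "bij_betw h (verts F) (verts F')"
    and hE: "\<And>u v. u \<in> verts F \<Longrightarrow> v \<in> verts F \<Longrightarrow> {u, v} \<in> edges F \<longleftrightarrow> {h u, h v} \<in> edges F'"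
    using assms(3) unfolding isomorphic_def by blast
  have img: "h ` verts F = verts F'"
    using h by (rule bij_betw_imp_surj_on)
  \<comment> \<open>\<open>hE\<close> speaks only of vertices of \<open>F\<close>; simplicity of
    \<open>F\<close> places the ends of an edge among them.\<close>
  have edge: "(h x, h y) \<in> {(x, y). {x, y} \<in> edges F'}" if "{x, y} \<in> edges F" for x y
    using that hE[of x y] assms(1) unfolding simple_graph_def by auto
  have "(h u, h v) \<in> {(x, y). {x, y} \<in> edges F'}\<^sup>*"
    if "(u, v) \<in> {(x, y). {x, y} \<in> edges F}\<^sup>*" for u v
    using that
  proof (induction rule: rtrancl_induct)
    case (step y z)
    have "{y, z} \<in> edges F"
      using step.hyps(2) by simp
    then show ?case
      by (rule rtrancl_into_rtrancl[OF step.IH edge])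
  qed simp
  moreover have "verts F' \<noteq> {}"
    using assms(2) img unfolding connected_graph_def by auto
  ultimately show ?thesis
    using assms(2) by (simp add: connected_graph_def flip: img)
qed

lemma Gamma3_connected_graph:
  assumes "F \<in> Gamma3"
  shows "connected_graph F"
proof (cases "k_connected 3 F")
  case True
  \<comment> \<open>The empty set is an admissible deletion because 0 < 3, and deleting nothing
    gives back \<open>F\<close>.\<close>
  then have "connected_graph (delete_verts F {})"
    unfolding k_connected_def by auto
  then show ?thesis
    by (cases F) (simp add: delete_verts_def)
next
  case False
  then have complete: "is_complete_graph 3 F"
    using assms by (simp add: Gamma3_def)
  have "(u, v) \<in> {(x, y). {x, y} \<in> edges F}\<^sup>*" if "u \<in> verts F" "v \<in> verts F" for u v
  proof (cases "u = v")
    case False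
    then have "{u, v} \<in> edges F"
      using that complete by (simp add: is_complete_graph_def)
    then show ?thesis by blast
  qed simp
  moreover have "verts F \<noteq> {}"
    using complete by (auto simp: is_complete_graph_def)
  ultimately show ?thesis
    by (simp add: connected_graph_def)
qed

definition induced :: "'v ugraph \<Rightarrow> 'v set \<Rightarrow> 'v ugraph" where
  "induced F A = \<lparr>verts = A, edges = {e \<in> edges F. e \<subseteq> A}\<rparr>"

lemma subgraph_induced:
  assumes "simple_graph F" "A \<subseteq> verts F"
  shows "subgraph (induced F A) F"
  using assms finite_subset unfolding subgraph_def simple_graph_def induced_def by auto

lemma good_coloring_subgraph:
  assumes "good_coloring G H F c" "subgraph F' F"
  shows "good_coloring G H F' c"
  using assms unfolding good_coloring_def subgraph_def by (meson subset_trans)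

definition glue :: "'v set \<Rightarrow> ('v set \<Rightarrow> color) \<Rightarrow> ('v set \<Rightarrow> color) \<Rightarrow> 'v set \<Rightarrow> color" where
  "glue A c d = (\<lambda>x. if x \<subseteq> A then c x else d x)"

text \<open>The copy is connected, so it lies inside \<open>A\<close> or avoids \<open>A\<close>,
  and only one of the two colorings is seen on it. The conclusion is asymmetric because
  \<open>c\<close> will be good only on \<open>induced T A\<close>, whereas \<open>d\<close> will be
  good on all of \<open>T\<close>.\<close>

lemma monochromatic_copy_glue:
  assumes "simple_graph G" "connected_graph G"
    and closed: "\<And>x y. {x, y} \<in> edges T \<Longrightarrow> x \<in> A \<longleftrightarrow> y \<in> A"
    and S: "subgraph S T" "isomorphic G S" "\<forall>e\<in>edges S. glue A c d e = col"
  shows "subgraph S (induced T A) \<and> (\<forall>e\<in>edges S. c e = col) \<or> (\<forall>e\<in>edges S. d e = col)"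
proof -
  have simple: "simple_graph S"
    using S(1) by (simp add: subgraph_def)
  have "verts S \<subseteq> A \<or> verts S \<inter> A = {}"
    by (rule connected_graph_closed_set[OF isomorphic_connected_graph[OF assms(1,2) S(2)]])
      (use S(1) closed in \<open>auto simp: subgraph_def\<close>)
  then show ?thesis
  proof
    assume "verts S \<subseteq> A"
    then have "e \<subseteq> A" if "e \<in> edges S" for e
      using that simple unfolding simple_graph_def by blast
    then show ?thesis
      using S \<open>verts S \<subseteq> A\<close> by (auto simp: subgraph_def induced_def glue_def)
  next
    assume "verts S \<inter> A = {}"
    \<comment> \<open>Nonemptiness matters: \<open>glue\<close> would color an empty edge by
      \<open>c\<close>, since the empty set is contained in \<open>A\<close>.\<close>
    moreover have "e \<subseteq> verts S \<and> e \<noteq> {}" if "e \<in> edges S" for e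
      using that simple unfolding simple_graph_def by fastforce
    ultimately have "\<not> e \<subseteq> A" if "e \<in> edges S" for e
      using that by blast
    then show ?thesis
      using S(3) by (auto simp: glue_def)
  qed
qed

lemma good_coloring_glue:
  assumes "G \<in> Gamma3" "H \<in> Gamma3"
    and closed: "\<And>x y. {x, y} \<in> edges T \<Longrightarrow> x \<in> A \<longleftrightarrow> y \<in> A"
    and c: "good_coloring G H (induced T A) c" and d: "good_coloring G H T d"
  shows "good_coloring G H T (glue A c d)"
proof -
  have G: "simple_graph G" "connected_graph G" and H: "simple_graph H" "connected_graph H"
    using assms(1,2) Gamma3_connected_graph by (auto simp: Gamma3_def)
  have "\<not> (\<forall>x\<in>edges S. glue A c d x = Red)" if "subgraph S T" "isomorphic G S" for S
    using monochromatic_copy_glue[OF G closed that, of c d Red] that c d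
    unfolding good_coloring_def by blast
  moreover have "\<not> (\<forall>x\<in>edges S. glue A c d x = Blue)" if "subgraph S T" "isomorphic H S" for S
    using monochromatic_copy_glue[OF H closed that, of c d Blue] that c d
    unfolding good_coloring_def by blast
  ultimately show ?thesis
    unfolding good_coloring_def by blast
qed

text \<open>Positive and negative senders are the cases where \<open>P\<close> is equality or inequality.\<close>

definition sender_for ::
  "(color \<Rightarrow> color \<Rightarrow> bool) \<Rightarrow> 'a ugraph \<Rightarrow> 'b ugraph \<Rightarrow> 'v ugraph \<Rightarrow> 'v set \<Rightarrow> 'v set \<Rightarrow> bool" where
  "sender_for P G H T e f \<longleftrightarrow>
     simple_graph T \<and> e \<in> edges T \<and> f \<in> edges T \<and> e \<noteq> f \<and>
     (\<exists>c. good_coloring G H T c) \<and>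
     (\<forall>c. good_coloring G H T c \<longrightarrow> P (c e) (c f)) \<and>
     (\<exists>c. good_coloring G H T c \<and> c e = Red) \<and>
     (\<exists>c. good_coloring G H T c \<and> c e = Blue)"

text \<open>The assumption on \<open>P\<close> says that no color of \<open>f\<close> is compatible
  with both colors of \<open>e\<close>. This is the form in which the dependence between the signal
  edges contradicts independent recoloring, and it treats both types of sender at once.\<close>

lemma minimal_sender_for_connected:
  assumes G: "G \<in> Gamma3" and H: "H \<in> Gamma3"
    and P: "\<And>b. \<not> (P Red b \<and> P Blue b)"
    and T: "sender_for P G H T e f"
    and minimal: "\<And>S. proper_subgraph S T \<Longrightarrow> \<not> sender_for P G H S e f"
  shows "connected_graph T"
proof -
  have simple: "simple_graph T" and e: "e \<in> edges T" and f: "f \<in> edges T"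
    and dep: "\<And>c. good_coloring G H T c \<Longrightarrow> P (c e) (c f)"
    using T unfolding sender_for_def by blast+
  obtain r b where r: "good_coloring G H T r" "r e = Red"
    and b: "good_coloring G H T b" "b e = Blue"
    using T unfolding sender_for_def by blast
  define R where "R = {(x, y). {x, y} \<in> edges T}"
  have "sym R"
    unfolding R_def by (auto intro!: symI simp: insert_commute)
  then have sym: "sym (R\<^sup>*)"
    by (rule sym_rtrancl)
  obtain u where u: "u \<in> e"
    using e simple unfolding simple_graph_def by fastforce
  \<comment> \<open>The vertex set of the component of \<open>T\<close> that contains
    \<open>e\<close>, described from an endpoint \<open>u\<close> of \<open>e\<close>.\<close>
  define A where "A = {v \<in> verts T. (u, v) \<in> R\<^sup>*}"
  have "u \<in> A"
    using u e simple unfolding A_def simple_graph_def by blast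
  have closed: "x \<in> A \<longleftrightarrow> y \<in> A" if "{x, y} \<in> edges T" for x y
  proof -
    have "(x, y) \<in> R" "(y, x) \<in> R"
      using that unfolding R_def by (auto simp: insert_commute)
    moreover have "x \<in> verts T" "y \<in> verts T"
      using that simple unfolding simple_graph_def by blast+
    ultimately show ?thesis
      unfolding A_def by (auto intro: rtrancl_into_rtrancl)
  qed
  have edge_in: "x \<subseteq> A" if "x \<in> edges T" "w \<in> x" "w \<in> A" for x w
  proof -
    have "card x = 2"
      using that simple by (simp add: simple_graph_def)
    then obtain p q where "x = {p, q}"
      by (auto simp: card_2_iff)
    then show ?thesis
      using that closed[of p q] by auto
  qed
  have eA: "e \<subseteq> A"
    using edge_in e u \<open>u \<in> A\<close> by blast
  have sub: "subgraph (induced T A) T"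
    by (rule subgraph_induced[OF simple]) (auto simp: A_def)
  have glue: "good_coloring G H T (glue A c d)"
    if "good_coloring G H (induced T A) c" "good_coloring G H T d" for c d
    using good_coloring_glue[OF G H closed that] .
  have fA: "f \<subseteq> A"
  proof (rule ccontr)
    assume "\<not> f \<subseteq> A"
    \<comment> \<open>Recoloring \<open>A\<close> by \<open>r\<close> turns \<open>e\<close> red,
      while \<open>f\<close>, not being inside \<open>A\<close>, keeps the color \<open>b f\<close>.
      Under \<open>b\<close> itself \<open>e\<close> is blue, so \<open>b f\<close> would be
      compatible with both colors.\<close>
    then have "P Red (b f)"
      using dep[OF glue[OF good_coloring_subgraph[OF r(1) sub] b(1)]] eA r(2)
      by (simp add: glue_def)
    moreover have "P Blue (b f)"
      using dep[OF b(1)] b(2) by simp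
    ultimately show False
      using P by blast
  qed
  have "sender_for P G H (induced T A) e f"
    unfolding sender_for_def
  proof (intro conjI allI impI)
    show "simple_graph (induced T A)"
      using sub by (simp add: subgraph_def)
    show "e \<in> edges (induced T A)" "f \<in> edges (induced T A)"
      using e f eA fA by (simp_all add: induced_def)
    show "e \<noteq> f"
      using T by (simp add: sender_for_def)
    \<comment> \<open>A good coloring \<open>c\<close> of the component extends to \<open>T\<close>
      by \<open>r\<close> outside \<open>A\<close>; both signal edges lie inside \<open>A\<close>
      and keep their colors under \<open>c\<close>.\<close>
    show "P (c e) (c f)" if "good_coloring G H (induced T A) c" for c
      using dep[OF glue[OF that r(1)]] eA fA by (simp add: glue_def)
  qed (use r b good_coloring_subgraph[OF _ sub] in blast)+
  then have "induced T A = T"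
    using minimal sub unfolding proper_subgraph_def by blast
  then have "verts T = A"
    by (metis induced_def ugraph.select_convs(1))
  then have "(u, v) \<in> R\<^sup>*" if "v \<in> verts T" for v
    using that unfolding A_def by blast
  \<comment> \<open>Paths are joined at \<open>u\<close>: the path from \<open>u\<close> to
    \<open>v\<close> is reversed and followed by the one from \<open>u\<close> to
    \<open>w\<close>.\<close>
  then have "(v, w) \<in> R\<^sup>*" if "v \<in> verts T" "w \<in> verts T" for v w
    using that sym by (meson rtrancl_trans symD)
  then show ?thesis
    using \<open>u \<in> A\<close> \<open>verts T = A\<close> unfolding connected_graph_def R_def by auto
qed

theorem theorem1:
  fixes G :: "'a ugraph" and H :: "'b ugraph" and T :: "'v ugraph" and e f :: "'v set"
  assumes "G \<in> Gamma3" and "H \<in> Gamma3"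
    and "has_negative_senders G H \<or> has_positive_senders G H"
    and "minimal_negative_sender G H T e f \<or> minimal_positive_sender G H T e f"
  shows "connected_graph T"
proof -
  have neg: "negative_sender G H S e f \<longleftrightarrow> sender_for (\<noteq>) G H S e f"
    and pos: "positive_sender G H S e f \<longleftrightarrow> sender_for (=) G H S e f" for S :: "'v ugraph"
    by (simp_all add: negative_sender_def positive_sender_def sender_for_def)
  from assms(4) show ?thesis
  proof
    assume "minimal_negative_sender G H T e f"
    \<comment> \<open>With only two colors, \<open>b\<close> cannot differ from both.\<close>
    moreover have "\<not> (Red \<noteq> b \<and> Blue \<noteq> b)" for b
      by (cases b) auto
    ultimately show ?thesis
      using minimal_sender_for_connected[OF assms(1,2), of "(\<noteq>)"]
      unfolding minimal_negative_sender_def neg by blast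
  next
    assume "minimal_positive_sender G H T e f"
    moreover have "\<not> (Red = b \<and> Blue = b)" for b
      by auto
    ultimately show ?thesis
      using minimal_sender_for_connected[OF assms(1,2), of "(=)"]
      unfolding minimal_positive_sender_def pos by blast
  qed
qed

end
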